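(* The spaces $P(bS_n)$, $B(bS_n)$ and $W(bS_n)$ are contractible for every $n\ge1$.
   Context: Permutations act on $[n]$; products composed right to left; $\tau_i=(i,i+1)$. $bS_n$: with $D(k,j)=\tau_k\tau_{k-1}\cdots\tau_j$ ($1\le j\le k\le n-1$), every $\pi\ne\mathrm{Id}$ has a unique expression $\pi=D(k_1,j_1)\cdots D(k_s,j_s)$ with $1\le k_1<\dots<k_s\le n-1$, $j_a\le k_a$, of length equal to the Coxeter length $\ell(\pi)$; $\pi\in bS_n$ if $\pi=\mathrm{Id}$ or each $\tau_i$ occurs at most once in this word. The permutahedron $P(\Sigma_n)$ is the convex hull of the points $v_\pi=(\pi^{-1}(1),\dots,\pi^{-1}(n))$, $\pi\in\Sigma_n$; its faces correspond to the cosets $\pi\Sigma_J$ of the standard parabolic subgroups $\Sigma_J=\langle\tau_j:j\in J\rangle$, $J\subseteq\{1,\dots,n-1\}$, the vertex set of the face being $\{v_\sigma:\sigma\in\pi\Sigma_J\}$. $P(bS_n)$ is the subcomplex consisting of the faces all of whose vertices correspond to elements of $bS_n$. Bruhat order: generated by the relations $\alpha<\beta$ when $\ell(\beta)=\ell(\alpha)+1$ and $\beta=\alpha(i,j)$ for some transposition $(i,j)$. Right weak order: generated by $\alpha<\beta$ when $\ell(\beta)=\ell(\alpha)+1$ and $\beta=\alpha\tau_i$. $B(bS_n)$ and $W(bS_n)$ are the order complexes (simplicial complexes of chains) of $bS_n$ with the order induced from the Bruhat order, respectively the weak order. *)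

theory Defs
  imports
    "HOL-Analysis.Analysis"
    "HOL-Analysis.Finite_Function_Topology"
    "HOL-Algebra.Sym_Groups"
begin

text \<open>The symmetric group on \<open>{1..n}\<close> is \<^const>\<open>sym_group\<close>, whose multiplication is \<open>(\<circ>)\<close>, so
  products are composed right to left.\<close>

definition adj_transp :: "nat \<Rightarrow> nat \<Rightarrow> nat" where
  "adj_transp i = Transposition.transpose i (Suc i)"

text \<open>A word is the list of the indices of its letters.\<close>

definition word_perm :: "nat list \<Rightarrow> nat \<Rightarrow> nat" where
  "word_perm ws = foldr (\<lambda>i p. adj_transp i \<circ> p) ws id"

definition coxeter_length :: "nat \<Rightarrow> (nat \<Rightarrow> nat) \<Rightarrow> nat" where
  "coxeter_length n p = (LEAST m. \<exists>ws. set ws \<subseteq> {1..<n} \<and> word_perm ws = p \<and> length ws = m)"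

definition D_word :: "nat \<Rightarrow> nat \<Rightarrow> nat list" where
  "D_word k j = rev [j..<Suc k]"

text \<open>The list \<open>[(k\<^sub>1,j\<^sub>1),\<dots>,(k\<^sub>s,j\<^sub>s)]\<close> encodes the expression \<open>D(k\<^sub>1,j\<^sub>1)\<dots>D(k\<^sub>s,j\<^sub>s)\<close>; the empty
  list encodes the identity.\<close>

definition canonical_indices :: "nat \<Rightarrow> (nat \<times> nat) list \<Rightarrow> bool" where
  "canonical_indices n kjs \<longleftrightarrow>
     sorted_wrt (<) (map fst kjs) \<and> (\<forall>(k, j) \<in> set kjs. 1 \<le> j \<and> j \<le> k \<and> k < n)"

definition canonical_word :: "(nat \<times> nat) list \<Rightarrow> nat list" where
  "canonical_word kjs = concat (map (\<lambda>(k, j). D_word k j) kjs)"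

text \<open>As the canonical expression of a permutation is unique, it is enough to ask for one
  without repeated letters.\<close>

definition bS :: "nat \<Rightarrow> (nat \<Rightarrow> nat) set" where
  "bS n = {p \<in> carrier (sym_group n).
     \<exists>kjs. canonical_indices n kjs \<and> p = word_perm (canonical_word kjs)
       \<and> distinct (canonical_word kjs)}"

text \<open>Euclidean \<open>n\<close>-space is realised as the finitely supported functions \<open>nat \<Rightarrow>\<^sub>0 real\<close> that vanish
  off \<open>{1..n}\<close>: the point with coordinates \<open>x\<^sub>1,\<dots>,x\<^sub>n\<close> is \<open>\<Sum>i=1..n. single i x\<^sub>i\<close>. The ambient type is
  a normed space (with the \<open>L\<^sup>1\<close> norm), which induces the usual topology on every
  finite-dimensional subspace.\<close>

definition perm_vertex :: "nat \<Rightarrow> (nat \<Rightarrow> nat) \<Rightarrow> nat \<Rightarrow>\<^sub>0 real" where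
  "perm_vertex n p = (\<Sum>i=1..n. Poly_Mapping.single i (real (Hilbert_Choice.inv p i)))"

definition parabolic :: "nat \<Rightarrow> nat set \<Rightarrow> (nat \<Rightarrow> nat) set" where
  "parabolic n J = generate (sym_group n) (adj_transp ` J)"

definition parabolic_cosets :: "nat \<Rightarrow> (nat \<Rightarrow> nat) set set" where
  "parabolic_cosets n =
     {p <#\<^bsub>sym_group n\<^esub> parabolic n J | p J. p \<in> carrier (sym_group n) \<and> J \<subseteq> {1..<n}}"

text \<open>The face of the permutahedron corresponding to a coset is the convex hull of its vertices.\<close>

definition perm_face :: "nat \<Rightarrow> (nat \<Rightarrow> nat) set \<Rightarrow> (nat \<Rightarrow>\<^sub>0 real) set" where
  "perm_face n C = convex hull (perm_vertex n ` C)"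

definition P_bS :: "nat \<Rightarrow> (nat \<Rightarrow>\<^sub>0 real) set" where
  "P_bS n = (\<Union>C \<in> {C \<in> parabolic_cosets n. C \<subseteq> bS n}. perm_face n C)"

definition bruhat_step :: "nat \<Rightarrow> (nat \<Rightarrow> nat) \<Rightarrow> (nat \<Rightarrow> nat) \<Rightarrow> bool" where
  "bruhat_step n a b \<longleftrightarrow>
     a \<in> carrier (sym_group n) \<and> b \<in> carrier (sym_group n) \<and>
     coxeter_length n b = coxeter_length n a + 1 \<and>
     (\<exists>i\<in>{1..n}. \<exists>j\<in>{1..n}. i \<noteq> j \<and> b = a \<circ> Transposition.transpose i j)"

definition bruhat_le :: "nat \<Rightarrow> (nat \<Rightarrow> nat) \<Rightarrow> (nat \<Rightarrow> nat) \<Rightarrow> bool" where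
  "bruhat_le n = (bruhat_step n)\<^sup>*\<^sup>*"

definition weak_step :: "nat \<Rightarrow> (nat \<Rightarrow> nat) \<Rightarrow> (nat \<Rightarrow> nat) \<Rightarrow> bool" where
  "weak_step n a b \<longleftrightarrow>
     a \<in> carrier (sym_group n) \<and> b \<in> carrier (sym_group n) \<and>
     coxeter_length n b = coxeter_length n a + 1 \<and>
     (\<exists>i\<in>{1..<n}. b = a \<circ> adj_transp i)"

definition weak_le :: "nat \<Rightarrow> (nat \<Rightarrow> nat) \<Rightarrow> (nat \<Rightarrow> nat) \<Rightarrow> bool" where
  "weak_le n = (weak_step n)\<^sup>*\<^sup>*"

definition order_complex :: "'a set \<Rightarrow> ('a \<Rightarrow> 'a \<Rightarrow> bool) \<Rightarrow> 'a set set" where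
  "order_complex A r =
     {C. C \<subseteq> A \<and> finite C \<and> C \<noteq> {} \<and> (\<forall>x\<in>C. \<forall>y\<in>C. r x y \<or> r y x)}"

text \<open>The vertices are placed at the standard basis vectors of \<open>'a \<Rightarrow>\<^sub>0 real\<close>, so points are given
  by their barycentric coordinates. The norm topology is the usual one as long as the complex is
  finite, which is the case below.\<close>

definition geometric_realization :: "'a set set \<Rightarrow> ('a \<Rightarrow>\<^sub>0 real) set" where
  "geometric_realization K = (\<Union>C\<in>K. convex hull ((\<lambda>x. Poly_Mapping.single x 1) ` C))"

definition B_bS :: "nat \<Rightarrow> ((nat \<Rightarrow> nat) \<Rightarrow>\<^sub>0 real) set" where
  "B_bS n = geometric_realization (order_complex (bS n) (bruhat_le n))"

definition W_bS :: "nat \<Rightarrow> ((nat \<Rightarrow> nat) \<Rightarrow>\<^sub>0 real) set" where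
  "W_bS n = geometric_realization (order_complex (bS n) (weak_le n))"

end

theory Submission
  imports Defs
begin

text \<open>The set \<open>bS n\<close> consists of the products of words with distinct letters. Such words are reduced, so
  the prefixes of one of them form a chain from the identity in the weak order: the identity is a
  least element for both orders, and the two order complexes are cones.

  For the permutahedron, \<open>bS n\<close> is closed under removing right descents, and no two right descents of
  \<open>w \<in> bS n\<close> are consecutive. The elements obtained from \<open>w\<close> by removing some of its right descents
  therefore span a cube that is a face of the permutahedron, and \<open>P_bS n\<close> is the union of these cubes.
  The face opposite to \<open>w\<close> in each direction lies in the cube of a smaller element, while a point of the
  cube that is on none of these faces determines \<open>w\<close>. So the cubes can be collapsed one by one, each
  onto its faces not containing \<open>w\<close>, until the identity is left. The order of the collapses is
  that of increasing \<open>\<Sum>i * w i\<close>, a quantity that grows when a descent is removed.\<close>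

section \<open>Words with distinct letters\<close>

lemma word_perm_Nil [simp]: "word_perm [] = id"
  by (simp add: word_perm_def)

lemma word_perm_Cons [simp]: "word_perm (i # ws) = adj_transp i \<circ> word_perm ws"
  by (simp add: word_perm_def)

lemma word_perm_append: "word_perm (u @ v) = word_perm u \<circ> word_perm v"
  by (induction u) (simp_all add: comp_assoc)

lemma adj_transp_simps [simp]: "adj_transp i i = Suc i" "adj_transp i (Suc i) = i"
  by (simp_all add: adj_transp_def)

lemma adj_transp_other: "x \<noteq> i \<Longrightarrow> x \<noteq> Suc i \<Longrightarrow> adj_transp i x = x"
  by (simp add: adj_transp_def)

lemma adj_transp_involutory [simp]: "adj_transp i (adj_transp i x) = x"
  by (simp add: adj_transp_def)

lemma adj_transp_permutes: "i \<in> {1..<n} \<Longrightarrow> adj_transp i permutes {1..n}"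
  unfolding adj_transp_def by (rule permutes_swap_id) auto

lemma word_perm_permutes: "set ws \<subseteq> {1..<n} \<Longrightarrow> word_perm ws permutes {1..n}"
proof (induction ws)
  case Nil
  then show ?case by (simp add: permutes_id id_def[symmetric])
next
  case (Cons i ws)
  then show ?case
    unfolding word_perm_Cons by (intro permutes_compose adj_transp_permutes) auto
qed

text \<open>Only \<open>adj_transp i\<close> moves points across the cut between \<open>i\<close>
  and \<open>Suc i\<close>. In a word with distinct letters, each cut is thus crossed by at most one
  letter.\<close>

lemma word_perm_le_iff: "i \<notin> set ws \<Longrightarrow> word_perm ws x \<le> i \<longleftrightarrow> x \<le> i"
proof (induction ws)
  case (Cons k ws)
  have "adj_transp k y \<le> i \<longleftrightarrow> y \<le> i" if "k \<noteq> i" for y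
    using that by (auto simp: adj_transp_def Transposition.transpose_def)
  with Cons show ?case by simp
qed simp

lemma word_perm_fixes:
  assumes "i \<notin> set ws" "Suc i \<notin> set ws"
  shows "word_perm ws (Suc i) = Suc i"
  using word_perm_le_iff[OF assms(1), of "Suc i"] word_perm_le_iff[OF assms(2), of "Suc i"]
  by simp

lemma word_perm_commute:
  assumes "\<And>i. i \<in> set ws \<Longrightarrow> i \<noteq> j \<and> Suc i \<noteq> j \<and> i \<noteq> Suc j"
  shows "word_perm ws \<circ> adj_transp j = adj_transp j \<circ> word_perm ws"
  using assms
proof (induction ws)
  case (Cons i ws)
  have ij: "i \<noteq> j" "Suc i \<noteq> j" "i \<noteq> Suc j"
    using Cons.prems[of i] by auto
  have "adj_transp i (adj_transp j x) = adj_transp j (adj_transp i x)" for x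
    using ij by (cases "x = i \<or> x = Suc i"; cases "x = j \<or> x = Suc j")
      (auto simp: adj_transp_other)
  moreover have "word_perm ws (adj_transp j x) = adj_transp j (word_perm ws x)" for x
    using Cons.IH Cons.prems by (simp add: fun_eq_iff)
  ultimately show ?case by (simp add: fun_eq_iff)
qed simp

text \<open>Without the letter \<open>j\<close>, the cut at \<open>j\<close> would keep the two
  values in order. The word acts from its right end, so a neighbouring letter in \<open>v\<close>
  would carry \<open>Suc j\<close> up or \<open>j\<close> down over its own cut before
  \<open>j\<close> acts. No other letter brings it back, and the values would again be
  increasing.\<close>

lemma descent_split:
  assumes "distinct ws" and desc: "word_perm ws (Suc j) < word_perm ws j"
  obtains u v where "ws = u @ j # v" "\<And>i. i \<in> set v \<Longrightarrow> i \<noteq> j \<and> Suc i \<noteq> j \<and> i \<noteq> Suc j"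
proof -
  have "j \<in> set ws"
    using desc word_perm_le_iff[of j ws j] word_perm_le_iff[of j ws "Suc j"] by force
  then obtain u v where ws: "ws = u @ j # v"
    by (meson split_list)
  with \<open>distinct ws\<close> have ju: "j \<notin> set u" and jv: "j \<notin> set v" by auto
  have perm: "word_perm ws x = word_perm u (adj_transp j (word_perm v x))" for x
    by (simp add: ws word_perm_append)
  have vj: "word_perm v j \<le> j" "Suc j \<le> word_perm v (Suc j)"
    using word_perm_le_iff[OF jv, of j] word_perm_le_iff[OF jv, of "Suc j"] by auto
  have "Suc j \<notin> set v"
  proof
    assume "Suc j \<in> set v"
    then obtain v1 v2 where v: "v = v1 @ Suc j # v2"
      by (meson split_list)
    with \<open>distinct ws\<close> ws have d: "Suc j \<notin> set u" "Suc j \<notin> set v1" "Suc j \<notin> set v2"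
      "j \<notin> set v2" by auto
    have "\<not> word_perm v (Suc j) \<le> Suc j"
      using word_perm_le_iff[OF d(2), of "Suc (Suc j)"] word_perm_fixes[OF d(4,3)]
      by (simp add: v word_perm_append)
    then have "\<not> word_perm ws (Suc j) \<le> Suc j"
      using word_perm_le_iff[OF d(1)] by (simp add: perm adj_transp_other)
    moreover have "adj_transp j (word_perm v j) \<le> Suc j"
      using vj(1) by (auto simp: adj_transp_def Transposition.transpose_def)
    then have "word_perm ws j \<le> Suc j"
      using word_perm_le_iff[OF d(1)] by (simp add: perm)
    ultimately show False using desc by simp
  qed
  moreover have "i \<notin> set v" if "Suc i = j" for i
  proof
    assume "i \<in> set v"
    then obtain v1 v2 where v: "v = v1 @ i # v2"
      by (meson split_list)
    with \<open>distinct ws\<close> ws have d: "i \<notin> set u" "i \<notin> set v1" "i \<notin> set v2" "Suc i \<notin> set v2"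
      using that by auto
    have "word_perm v j \<le> i"
      using word_perm_le_iff[OF d(2), of i] word_perm_fixes[OF d(3,4)] that
      by (auto simp: v word_perm_append)
    then have "word_perm ws j \<le> i"
      using word_perm_le_iff[OF d(1)] that by (auto simp: perm adj_transp_other)
    moreover have "\<not> adj_transp j (word_perm v (Suc j)) \<le> i"
      using vj(2) that by (auto simp: adj_transp_def Transposition.transpose_def)
    then have "\<not> word_perm ws (Suc j) \<le> i"
      using word_perm_le_iff[OF d(1)] by (simp add: perm)
    ultimately show False using desc by simp
  qed
  ultimately show ?thesis using that ws jv by metis
qed

text \<open>The letter \<open>j\<close> commutes past \<open>v\<close> to the right end of the word
  and cancels against \<open>adj_transp j\<close>.\<close>

lemma descent_delete:
  assumes "distinct ws" "word_perm ws (Suc j) < word_perm ws j"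
  obtains ws' where "distinct ws'" "set ws' = set ws - {j}"
    "word_perm ws \<circ> adj_transp j = word_perm ws'"
proof -
  obtain u v where ws: "ws = u @ j # v"
    and v: "\<And>i. i \<in> set v \<Longrightarrow> i \<noteq> j \<and> Suc i \<noteq> j \<and> i \<noteq> Suc j"
    using assms by (rule descent_split) blast
  have "adj_transp j \<circ> word_perm v \<circ> adj_transp j = word_perm v"
    using word_perm_commute[OF v] by (simp add: fun_eq_iff)
  then have "word_perm ws \<circ> adj_transp j = word_perm (u @ v)"
    by (simp add: ws word_perm_append comp_assoc)
  then show ?thesis
    using that[of "u @ v"] assms(1) ws by auto
qed

text \<open>Both letters would occur, and by \<open>descent_split\<close> neither could stand to the
  right of the other.\<close>

lemma no_double_descent:
  assumes "distinct ws" "word_perm ws (Suc j) < word_perm ws j"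
  shows "\<not> word_perm ws (Suc (Suc j)) < word_perm ws (Suc j)"
proof
  assume d: "word_perm ws (Suc (Suc j)) < word_perm ws (Suc j)"
  obtain u v where ws: "ws = u @ j # v" and v: "Suc j \<notin> set v"
    using assms by (rule descent_split) blast
  obtain u' v' where ws': "ws = u' @ Suc j # v'" and v': "j \<notin> set v'"
    using assms(1) d by (rule descent_split) blast
  have "Suc j \<in> set u"
    using ws ws' v by (metis in_set_conv_decomp n_not_Suc_n set_ConsD Un_iff set_append)
  then obtain u1 u2 where "u = u1 @ Suc j # u2"
    by (meson split_list)
  then have "u' @ Suc j # v' = u1 @ Suc j # (u2 @ j # v)"
    using ws ws' by simp
  moreover have "Suc j \<notin> set u'" "Suc j \<notin> set v'"
    using assms(1) ws' by auto
  ultimately have "v' = u2 @ j # v"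
    by (metis append_Cons_eq_iff assms(1) distinct_append not_distinct_conv_prefix ws')
  with v' show False by simp
qed

text \<open>The point that \<open>v\<close> sends to \<open>i\<close> is carried over the cut at
  \<open>i\<close> by the letter \<open>i\<close> and stays above it, which a word without
  \<open>i\<close> cannot do.\<close>

lemma letter_determined:
  assumes "distinct ws" "i \<in> set ws" "word_perm ws = word_perm ws'"
  shows "i \<in> set ws'"
proof (rule ccontr)
  assume "i \<notin> set ws'"
  obtain u v where ws: "ws = u @ i # v"
    using assms(2) by (meson split_list)
  with assms(1) have iu: "i \<notin> set u" and iv: "i \<notin> set v" by auto
  have "surj (word_perm v)"
  proof (induction v)
    case (Cons k v)
    have "surj (adj_transp k)"
      by (metis adj_transp_involutory surjI)
    with Cons show ?case unfolding word_perm_Cons by (intro comp_surj)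
  qed simp
  then obtain x where x: "word_perm v x = i" by (metis surjD)
  then have "x \<le> i" using word_perm_le_iff[OF iv, of x] by simp
  moreover have "\<not> word_perm ws x \<le> i"
    using word_perm_le_iff[OF iu] x by (simp add: ws word_perm_append)
  ultimately show False
    using word_perm_le_iff[OF \<open>i \<notin> set ws'\<close>] assms(3) by simp
qed

text \<open>By \<open>letter_determined\<close>, every word for the same permutation contains all
  letters of \<open>ws\<close>, so \<open>ws\<close> is reduced.\<close>

lemma coxeter_length_distinct:
  assumes "distinct ws" "set ws \<subseteq> {1..<n}"
  shows "coxeter_length n (word_perm ws) = length ws"
  unfolding coxeter_length_def
proof (rule Least_equality)
  fix m
  assume "\<exists>ws'. set ws' \<subseteq> {1..<n} \<and> word_perm ws' = word_perm ws \<and> length ws' = m"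
  then obtain ws' where "word_perm ws' = word_perm ws" "length ws' = m" by blast
  then have "set ws \<subseteq> set ws'"
    using letter_determined[OF assms(1), of _ ws'] by auto
  then show "length ws \<le> m"
    using \<open>length ws' = m\<close> distinct_card[OF assms(1)]
    by (metis List.finite_set card_length card_mono order_trans)
qed (use assms in blast)

section \<open>Canonical words\<close>

lemma canonical_word_snoc:
  "canonical_word (kjs @ [(k, j)]) = canonical_word kjs @ D_word k j"
  by (simp add: canonical_word_def)

lemma set_D_word: "set (D_word k j) = {j..k}"
  by (auto simp: D_word_def)

lemma set_canonical_word: "set (canonical_word kjs) = (\<Union>(k, j) \<in> set kjs. {j..k})"
  by (auto simp: canonical_word_def set_D_word)

text \<open>The largest letter \<open>m\<close> is taken out and put back into a canonical word for
  the rest, as a new last block or at the front of the last block. The letter sets belong to the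
  claim because they bound the block indices by \<open>m\<close> in the induction.\<close>

lemma canonical_form:
  assumes "distinct ws" "set ws \<subseteq> {1..<n}"
  shows "\<exists>kjs. canonical_indices n kjs \<and> word_perm (canonical_word kjs) = word_perm ws
           \<and> distinct (canonical_word kjs) \<and> set (canonical_word kjs) = set ws"
  using assms
proof (induction "length ws" arbitrary: ws rule: less_induct)
  case less
  show ?case
  proof (cases "ws = []")
    case True
    then show ?thesis
      by (intro exI[of _ "[]"]) (simp add: canonical_indices_def canonical_word_def)
  next
    case False
    define m where "m = Max (set ws)"
    have "m \<in> set ws"
      using False by (simp add: m_def)
    then obtain u v where ws: "ws = u @ m # v"
      by (meson split_list)
    have uv: "distinct (u @ v)" "set (u @ v) \<subseteq> {1..<n}" "m \<notin> set (u @ v)"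
      using less.prems ws by auto
    have lt: "i < m" if "i \<in> set (u @ v)" for i
      using that uv(3) Max_ge[of "set ws" i] unfolding m_def[symmetric]
      by (auto simp: ws le_less)
    obtain kjs where kjs: "canonical_indices n kjs" "distinct (canonical_word kjs)"
        "word_perm (canonical_word kjs) = word_perm (u @ v)"
        "set (canonical_word kjs) = set (u @ v)"
      using less.hyps[of "u @ v"] uv ws by auto
    have klt: "k < m" if "(k, j) \<in> set kjs" for k j
    proof -
      have "j \<le> k"
        using kjs(1) that by (auto simp: canonical_indices_def)
      then have "k \<in> set (canonical_word kjs)"
        by (auto simp: set_canonical_word intro!: bexI[OF _ that])
      then show ?thesis using kjs(4) lt by blast
    qed
    have mn: "1 \<le> m" "m < n"
      using less.prems(2) \<open>m \<in> set ws\<close> by auto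
    show ?thesis
    \<comment> \<open>If \<open>m - 1\<close> is not in \<open>v\<close>, then \<open>m\<close>
      commutes past \<open>v\<close> to the right end. Otherwise \<open>m - 1\<close> is not in
      \<open>u\<close>, and \<open>m\<close> commutes to the front.\<close>
    proof (cases "\<exists>i. i \<in> set v \<and> Suc i = m")
      case False
      have "word_perm v \<circ> adj_transp m = adj_transp m \<circ> word_perm v"
        by (rule word_perm_commute) (use False lt in force)
      then have "word_perm ws = word_perm (u @ v) \<circ> adj_transp m"
        by (simp add: ws word_perm_append comp_assoc)
      then have "word_perm (canonical_word (kjs @ [(m, m)])) = word_perm ws"
        using kjs(3) by (simp add: canonical_word_snoc word_perm_append D_word_def)
      moreover have "canonical_indices n (kjs @ [(m, m)])"
        using kjs(1) klt mn by (auto simp: canonical_indices_def sorted_wrt_append)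
      moreover have "distinct (canonical_word (kjs @ [(m, m)]))"
        "set (canonical_word (kjs @ [(m, m)])) = set ws"
        using kjs(2,4) uv(3) by (auto simp: canonical_word_snoc D_word_def ws)
      ultimately show ?thesis by blast
    next
      case True
      then obtain i where i: "i \<in> set v" "Suc i = m" by blast
      have "i \<notin> set u"
        using uv(1) i by auto
      have u: "word_perm u \<circ> adj_transp m = adj_transp m \<circ> word_perm u"
        by (rule word_perm_commute) (use \<open>i \<notin> set u\<close> i lt in force)
      have "i \<in> set (canonical_word kjs)"
        using i(1) kjs(4) by simp
      then obtain k' j' where k': "(k', j') \<in> set kjs" "i \<le> k'"
        by (auto simp: set_canonical_word)
      then have "k' = i" using klt i(2) by fastforce
      have "kjs \<noteq> []" using k' by auto
      then obtain kjs' k j where snoc: "kjs = kjs' @ [(k, j)]"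
        by (metis append_butlast_last_id surj_pair)
      have sorted: "sorted_wrt (<) (map fst kjs')" "\<forall>(k0, j0) \<in> set kjs'. k0 < k"
        "\<forall>(k0, j0) \<in> set kjs'. 1 \<le> j0 \<and> j0 \<le> k0 \<and> k0 < n" "1 \<le> j" "j \<le> k"
        using kjs(1) by (auto simp: snoc canonical_indices_def sorted_wrt_append)
      \<comment> \<open>The last block starts with \<open>i\<close>, so \<open>m\<close> extends it;
        the earlier blocks have only letters below \<open>i\<close> and commute with
        \<open>m\<close>.\<close>
      have "i \<le> k"
        using k' \<open>k' = i\<close> sorted(2) by (auto simp: snoc)
      moreover have "k < m" using klt[of k j] by (simp add: snoc)
      ultimately have "k = i" using i(2) by simp
      have D: "D_word m j = m # D_word k j"
        using sorted(5) i(2) \<open>k = i\<close> by (simp add: D_word_def)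
      have "l < i" if "l \<in> set (canonical_word kjs')" for l
        using that sorted(2) \<open>k = i\<close> by (auto simp: set_canonical_word)
      then have "word_perm (canonical_word kjs') \<circ> adj_transp m
          = adj_transp m \<circ> word_perm (canonical_word kjs')"
        using i(2) by (intro word_perm_commute) fastforce
      then have "word_perm (canonical_word (kjs' @ [(m, j)]))
          = adj_transp m \<circ> word_perm (canonical_word kjs)"
        by (simp add: snoc canonical_word_snoc word_perm_append D flip: comp_assoc)
      also have "\<dots> = word_perm ws"
        using u by (simp add: kjs(3) ws word_perm_append flip: comp_assoc)
      finally have "word_perm (canonical_word (kjs' @ [(m, j)])) = word_perm ws" .
      moreover have "canonical_indices n (kjs' @ [(m, j)])"
        using sorted mn \<open>k < m\<close> by (auto simp: canonical_indices_def sorted_wrt_append)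
      moreover have "set (canonical_word (kjs' @ [(m, j)])) = insert m (set (canonical_word kjs))"
        by (auto simp: snoc canonical_word_snoc D)
      then have "set (canonical_word (kjs' @ [(m, j)])) = set ws"
        using kjs(4) by (simp add: ws)
      moreover have "distinct (canonical_word (kjs' @ [(m, j)]))"
        using kjs(2) uv(3) unfolding kjs(4)[symmetric]
        by (auto simp: snoc canonical_word_snoc D)
      ultimately show ?thesis by blast
    qed
  qed
qed

text \<open>Frees \<open>bS n\<close> from canonical words, so that prefixes of a word and words
  with a letter deleted stay in it.\<close>

lemma bS_eq: "bS n = {word_perm ws | ws. distinct ws \<and> set ws \<subseteq> {1..<n}}"
proof (intro equalityI subsetI)
  fix p assume "p \<in> bS n"
  then obtain kjs where "canonical_indices n kjs" "p = word_perm (canonical_word kjs)"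
    "distinct (canonical_word kjs)"
    by (auto simp: bS_def)
  moreover from this(1) have "set (canonical_word kjs) \<subseteq> {1..<n}"
    by (fastforce simp: canonical_indices_def set_canonical_word)
  ultimately show "p \<in> {word_perm ws | ws. distinct ws \<and> set ws \<subseteq> {1..<n}}" by blast
next
  fix p assume "p \<in> {word_perm ws | ws. distinct ws \<and> set ws \<subseteq> {1..<n}}"
  then obtain ws where ws: "distinct ws" "set ws \<subseteq> {1..<n}" "p = word_perm ws" by blast
  then show "p \<in> bS n"
    using canonical_form[OF ws(1,2)] word_perm_permutes[OF ws(2)]
    unfolding bS_def sym_group_carrier by force
qed

section \<open>The order complexes\<close>

lemma weak_le_id:
  assumes "p \<in> bS n"
  shows "weak_le n id p"
proof -
  obtain ws where "distinct ws" "set ws \<subseteq> {1..<n}" "p = word_perm ws"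
    using assms by (auto simp: bS_eq)
  then show ?thesis
  proof (induction ws arbitrary: p rule: rev_induct)
    case Nil
    then show ?case by (simp add: weak_le_def)
  next
    case (snoc i ws)
    have "weak_le n id (word_perm ws)"
      by (rule snoc.IH) (use snoc.prems in auto)
    moreover have "weak_step n (word_perm ws) p"
      unfolding weak_step_def sym_group_carrier
    proof (intro conjI)
      show "p permutes {1..n}" "word_perm ws permutes {1..n}"
        unfolding snoc.prems(3) by (intro word_perm_permutes; use snoc.prems(2) in simp)+
      show "coxeter_length n p = coxeter_length n (word_perm ws) + 1"
        using snoc.prems coxeter_length_distinct[of "ws @ [i]" n] coxeter_length_distinct[of ws n]
        by simp
      have "p = word_perm ws \<circ> adj_transp i"
        unfolding snoc.prems(3) word_perm_append word_perm_Cons word_perm_Nil comp_id ..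
      then show "\<exists>i\<in>{1..<n}. p = word_perm ws \<circ> adj_transp i"
        using snoc.prems(2) by auto
    qed
    ultimately show ?case
      unfolding weak_le_def by (metis rtranclp.rtrancl_into_rtrancl)
  qed
qed

lemma weak_le_imp_bruhat_le: "weak_le n p q \<Longrightarrow> bruhat_le n p q"
proof -
  have "weak_step n \<le> bruhat_step n"
  proof (intro predicate2I)
    fix p q assume step: "weak_step n p q"
    then obtain i where "i \<in> {1..<n}" "q = p \<circ> adj_transp i"
      by (auto simp: weak_step_def)
    then have "i \<in> {1..n}" "Suc i \<in> {1..n}" "i \<noteq> Suc i"
      "q = p \<circ> Transposition.transpose i (Suc i)"
      by (auto simp: adj_transp_def)
    then show "bruhat_step n p q"
      using step unfolding weak_step_def bruhat_step_def by blast
  qed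
  then show "weak_le n p q \<Longrightarrow> bruhat_le n p q"
    unfolding weak_le_def bruhat_le_def using rtranclp_mono by blast
qed

lemma id_in_bS: "id \<in> bS n"
proof -
  have "id = word_perm [] \<and> distinct ([] :: nat list) \<and> set ([] :: nat list) \<subseteq> {1..<n}"
    by simp
  then show ?thesis unfolding bS_eq by blast
qed

text \<open>Adding \<open>b\<close> to a chain gives a chain, so the segment from the vertex of
  \<open>b\<close> to any point of a simplex stays in the complex.\<close>

lemma contractible_order_complex_bot:
  assumes "b \<in> A" "\<And>x. x \<in> A \<Longrightarrow> r b x"
  shows "geometric_realization (order_complex A r) \<noteq> {}
       \<and> contractible (geometric_realization (order_complex A r))"
proof -
  let ?e = "\<lambda>x. Poly_Mapping.single x (1::real)"
  let ?X = "geometric_realization (order_complex A r)"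
  have chain: "insert b C \<in> order_complex A r" if "C \<in> order_complex A r" for C
    using that assms by (auto simp: order_complex_def)
  have b: "?e b \<in> ?X"
  proof -
    have "{b} \<in> order_complex A r"
      using assms by (auto simp: order_complex_def)
    then show ?thesis by (force simp: geometric_realization_def)
  qed
  have "closed_segment (?e b) x \<subseteq> ?X" if "x \<in> ?X" for x
  proof -
    have "\<exists>C\<in>order_complex A r. x \<in> convex hull (?e ` C)"
      using that unfolding geometric_realization_def by (simp only: UN_iff)
    then obtain C where C: "C \<in> order_complex A r" "x \<in> convex hull (?e ` C)"
      by blast
    have "x \<in> convex hull (?e ` insert b C)" "?e b \<in> convex hull (?e ` insert b C)"
      using C(2) hull_mono[of "?e ` C" "?e ` insert b C"] by (auto simp: hull_inc)
    then have "closed_segment (?e b) x \<subseteq> convex hull (?e ` insert b C)"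
      by (intro closed_segment_subset convex_convex_hull)
    also have "\<dots> \<subseteq> ?X"
      unfolding geometric_realization_def by (rule UN_upper[OF chain[OF C(1)]])
    finally show ?thesis .
  qed
  then have "starlike ?X"
    using b unfolding starlike_def by blast
  then show ?thesis
    using b starlike_imp_contractible by blast
qed

lemma contractible_B_bS: "B_bS n \<noteq> {} \<and> contractible (B_bS n)"
  unfolding B_bS_def
  by (rule contractible_order_complex_bot) (blast intro: id_in_bS weak_le_imp_bruhat_le weak_le_id)+

lemma contractible_W_bS: "W_bS n \<noteq> {} \<and> contractible (W_bS n)"
  unfolding W_bS_def by (rule contractible_order_complex_bot) (blast intro: id_in_bS weak_le_id)+

section \<open>Gluing along a deformation retract\<close>

text \<open>The deformation \<open>h\<close> of \<open>B\<close> into \<open>A\<close> fixes the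
  overlap, so it extends by the identity on \<open>A\<close>. Its end map \<open>r\<close> is then
  followed by the contraction of \<open>A\<close>.\<close>

lemma contractible_Un_deformation_retract:
  fixes A B :: "'a::topological_space set"
  assumes "closed A" "closed B" "contractible A"
    and h: "continuous_on ({0..1} \<times> B) h"
    and hB: "\<And>t x. t \<in> {0..1} \<Longrightarrow> x \<in> B \<Longrightarrow> h (t, x) \<in> B"
    and h0: "\<And>x. x \<in> B \<Longrightarrow> h (0::real, x) = x"
    and h1: "\<And>x. x \<in> B \<Longrightarrow> h (1, x) \<in> A"
    and hA: "\<And>t x. t \<in> {0..1} \<Longrightarrow> x \<in> A \<Longrightarrow> x \<in> B \<Longrightarrow> h (t, x) = x"
  shows "contractible (A \<union> B)"
proof -
  define H where "H = (\<lambda>z. if snd z \<in> B then h z else snd z)"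
  \<comment> \<open>On \<open>A\<close> the map \<open>H\<close> is the projection: off
    \<open>B\<close> by definition, on the overlap by \<open>hA\<close>.\<close>
  have "continuous_on ({0..1} \<times> A) H"
  proof (rule continuous_on_eq)
    show "continuous_on ({0..1::real} \<times> A) snd"
      by (intro continuous_intros)
    show "snd z = H z" if "z \<in> {0..1} \<times> A" for z
      using that hA[of "fst z" "snd z"] by (cases z) (simp add: H_def)
  qed
  moreover have "continuous_on ({0..1} \<times> B) H"
    by (rule continuous_on_eq[OF h]) (auto simp: H_def)
  ultimately have cont: "continuous_on ({0..1} \<times> (A \<union> B)) H"
    unfolding Sigma_Un_distrib2
    by (intro continuous_on_closed_Un closed_Times assms closed_atLeastAtMost)
  have HAB: "H \<in> {0..1} \<times> (A \<union> B) \<rightarrow> A \<union> B"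
    using hB by (force simp: H_def split: if_splits)
  define r where "r = (\<lambda>x. H (1, x))"
  have "homotopic_with_canon (\<lambda>x. True) (A \<union> B) (A \<union> B) id r"
    unfolding homotopic_with_def
  proof (intro exI[of _ H] conjI)
    show "continuous_map (prod_topology (top_of_set {0..1}) (top_of_set (A \<union> B)))
        (top_of_set (A \<union> B)) H"
      using cont HAB by simp
  qed (auto simp: H_def r_def h0)
  moreover have "homotopic_with_canon (\<lambda>x. True) (A \<union> B) (A \<union> B) r (\<lambda>x. c)"
    if c: "homotopic_with_canon (\<lambda>x. True) A A id (\<lambda>x. c)" for c
  proof -
    have "continuous_on (A \<union> B) r"
      unfolding r_def by (rule continuous_on_compose2[OF cont]) (auto intro: continuous_intros)
    moreover have "r \<in> A \<union> B \<rightarrow> A"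
      using h1 by (auto simp: r_def H_def)
    ultimately have "continuous_map (top_of_set (A \<union> B)) (top_of_set A) r"
      by simp
    then have "homotopic_with_canon (\<lambda>x. True) (A \<union> B) A (id \<circ> r) ((\<lambda>x. c) \<circ> r)"
      by (rule homotopic_with_compose_continuous_map_right[OF c]) simp
    then have "homotopic_with_canon (\<lambda>x. True) (A \<union> B) A r (\<lambda>x. c)"
      unfolding comp_def id_def .
    then show ?thesis
      by (rule homotopic_with_subset_right) (rule Un_upper1)
  qed
  ultimately show ?thesis
    using \<open>contractible A\<close> unfolding contractible_def
    by (blast intro: homotopic_with_trans)
qed

section \<open>Coordinates on the permutahedron\<close>

lemma lookup_scaleR: "Poly_Mapping.lookup (c *\<^sub>R x) a = c *\<^sub>R Poly_Mapping.lookup x a"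
  unfolding scaleR_poly_mapping_def by (subst Abs_poly_mapping_inverse)
    (auto intro: finite_subset[OF _ finite_lookup[of x]])

text \<open>The L1 norm bounds each coordinate, which is therefore a bounded linear
  functional.\<close>

lemma continuous_on_lookup [continuous_intros]:
  fixes f :: "'b::topological_space \<Rightarrow> 'a \<Rightarrow>\<^sub>0 real"
  assumes "continuous_on S f"
  shows "continuous_on S (\<lambda>x. Poly_Mapping.lookup (f x) a)"
proof -
  have "bounded_linear (\<lambda>x::'a \<Rightarrow>\<^sub>0 real. Poly_Mapping.lookup x a)"
  proof (rule bounded_linear_intro[of _ 1])
    fix x :: "'a \<Rightarrow>\<^sub>0 real"
    have n: "norm x = (\<Sum>i\<in>Poly_Mapping.keys x. \<bar>Poly_Mapping.lookup x i\<bar>)"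
      by (simp add: norm_poly_mapping_def dist_poly_mapping_def)
    show "norm (Poly_Mapping.lookup x a) \<le> norm x * 1"
    proof (cases "a \<in> Poly_Mapping.keys x")
      case True
      then show ?thesis
        using member_le_sum[of a "Poly_Mapping.keys x" "\<lambda>i. \<bar>Poly_Mapping.lookup x i\<bar>"]
        by (simp add: n)
    qed (simp add: in_keys_iff)
  qed (auto simp: lookup_add lookup_scaleR)
  then show ?thesis
    using assms by (rule bounded_linear.continuous_on)
qed

lemma continuous_on_Min_image:
  fixes f :: "'i \<Rightarrow> 'a::topological_space \<Rightarrow> 'b::linorder_topology"
  assumes "finite I" "I \<noteq> {}" "\<And>i. i \<in> I \<Longrightarrow> continuous_on S (f i)"
  shows "continuous_on S (\<lambda>x. Min ((\<lambda>i. f i x) ` I))"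
  using assms
proof (induction I rule: finite_ne_induct)
  case (insert i I)
  then have "continuous_on S (\<lambda>x. min (f i x) (Min ((\<lambda>i. f i x) ` I)))"
    by (intro continuous_on_min) auto
  with insert show ?case by simp
qed simp

text \<open>The parallelepiped at \<open>a\<close>. Its parameter description is convex; conversely,
  each point lies on a segment in direction \<open>u k\<close> between the facets
  \<open>t k = 0\<close> and \<open>t k = 1\<close>.\<close>

lemma convex_hull_subset_sums:
  fixes a :: "'a::real_vector"
  assumes "finite K"
  shows "convex hull {a + sum u L | L. L \<subseteq> K}
       = {a + (\<Sum>j\<in>K. t j *\<^sub>R u j) | t. \<forall>j\<in>K. 0 \<le> t j \<and> t j \<le> 1}" (is "?H = ?Z a K")
proof
  show "?H \<subseteq> ?Z a K"
  proof (rule hull_minimal)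
    show "{a + sum u L | L. L \<subseteq> K} \<subseteq> ?Z a K"
    proof clarify
      fix L assume "L \<subseteq> K"
      then have "(\<Sum>j\<in>K. of_bool (j \<in> L) *\<^sub>R u j) = sum u L"
        using assms by (intro sum.mono_neutral_cong_right) auto
      then show "\<exists>t. a + sum u L = a + (\<Sum>j\<in>K. t j *\<^sub>R u j) \<and> (\<forall>j\<in>K. 0 \<le> t j \<and> t j \<le> (1::real))"
        by (intro exI[of _ "\<lambda>j. of_bool (j \<in> L)"]) simp
    qed
    show "convex (?Z a K)"
    proof (rule convexI)
      fix x y and c d :: real
      assume "x \<in> ?Z a K" "y \<in> ?Z a K" and cd: "0 \<le> c" "0 \<le> d" "c + d = 1"
      then obtain s t where s: "x = a + (\<Sum>j\<in>K. s j *\<^sub>R u j)" "\<forall>j\<in>K. 0 \<le> s j \<and> s j \<le> 1"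
        and t: "y = a + (\<Sum>j\<in>K. t j *\<^sub>R u j)" "\<forall>j\<in>K. 0 \<le> t j \<and> t j \<le> 1"
        by blast
      have "c *\<^sub>R x + d *\<^sub>R y = (c + d) *\<^sub>R a + (\<Sum>j\<in>K. (c * s j + d * t j) *\<^sub>R u j)"
        by (simp add: s(1) t(1) scaleR_add_right scaleR_add_left scaleR_sum_right sum.distrib)
      moreover have "0 \<le> c * s j + d * t j \<and> c * s j + d * t j \<le> 1" if "j \<in> K" for j
        using that s(2) t(2) cd by (simp add: convex_bound_le)
      ultimately show "c *\<^sub>R x + d *\<^sub>R y \<in> ?Z a K"
        using cd(3) by (intro CollectI exI[of _ "\<lambda>j. c * s j + d * t j"]) auto
    qed
  qed
  have "a + (\<Sum>j\<in>K. t j *\<^sub>R u j) \<in> convex hull {a + sum u L | L. L \<subseteq> K}"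
    if "\<forall>j\<in>K. 0 \<le> t j \<and> t j \<le> 1" for t
    using assms that
  \<comment> \<open>The base point varies because the facet \<open>t k = 1\<close> starts at
    \<open>a + u k\<close>.\<close>
  proof (induction K arbitrary: a rule: finite_induct)
    case (insert k K)
    let ?V = "\<lambda>a K. convex hull {a + sum u L | L. L \<subseteq> K}"
    let ?s = "\<Sum>j\<in>K. t j *\<^sub>R u j"
    have "?V a K \<subseteq> ?V a (insert k K)"
      by (intro hull_mono) blast
    moreover have "?V (a + u k) K \<subseteq> ?V a (insert k K)"
    proof (intro hull_mono subsetI)
      fix x assume "x \<in> {a + u k + sum u L | L. L \<subseteq> K}"
      then obtain L where L: "x = a + u k + sum u L" "L \<subseteq> K" by blast
      then have "k \<notin> L" "finite L"
        using insert.hyps by (auto intro: finite_subset)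
      then have "x = a + sum u (insert k L)"
        using L by (simp add: add.assoc)
      then show "x \<in> {a + sum u L | L. L \<subseteq> insert k K}"
        using L(2) by blast
    qed
    ultimately have "a + ?s \<in> ?V a (insert k K)" "a + u k + ?s \<in> ?V a (insert k K)"
      using insert.IH insert.prems by blast+
    then have "(1 - t k) *\<^sub>R (a + ?s) + t k *\<^sub>R (a + u k + ?s) \<in> ?V a (insert k K)"
      using insert.prems by (intro convexD[OF convex_convex_hull]) auto
    also have "(1 - t k) *\<^sub>R (a + ?s) + t k *\<^sub>R (a + u k + ?s)
        = a + (\<Sum>j\<in>insert k K. t j *\<^sub>R u j)"
      using insert.hyps by (simp add: algebra_simps)
    finally show ?case .
  qed (auto intro: hull_inc)
  then show "?Z a K \<subseteq> ?H" by blast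
qed

section \<open>Descents and flips\<close>

definition descents :: "nat \<Rightarrow> (nat \<Rightarrow> nat) \<Rightarrow> nat set" where
  "descents n p = {i \<in> {1..<n}. p (Suc i) < p i}"

definition sparse :: "nat set \<Rightarrow> bool" where
  "sparse K \<longleftrightarrow> (\<forall>k\<in>K. Suc k \<notin> K)"

text \<open>For sparse \<open>K\<close> this is the product of the commuting transpositions \<open>\<tau>\<^sub>k\<close> with \<open>k \<in> K\<close>.\<close>

definition flip :: "nat set \<Rightarrow> nat \<Rightarrow> nat" where
  "flip K i = (if i \<in> K then Suc i else if \<exists>k\<in>K. i = Suc k then i - 1 else i)"

lemma sparse_subset: "sparse K \<Longrightarrow> L \<subseteq> K \<Longrightarrow> sparse L"
  by (auto simp: sparse_def)

lemma finite_descents [simp]: "finite (descents n p)"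
  by (simp add: descents_def)

lemma flip_empty [simp]: "flip {} = id"
  by (simp add: flip_def fun_eq_iff)

lemma flip_at:
  assumes "sparse J" "K \<subseteq> J" "j \<in> J"
  shows "flip K j = (if j \<in> K then Suc j else j)" "flip K (Suc j) = (if j \<in> K then j else Suc j)"
  using assms by (auto simp: flip_def sparse_def)

lemma flip_other:
  assumes "K \<subseteq> J" "i \<notin> J" "i \<notin> Suc ` J"
  shows "flip K i = i"
  using assms by (auto simp: flip_def)

text \<open>By sparsity the pairs \<open>{j, Suc j}\<close> with \<open>j \<in> J\<close> are
  disjoint, and two swaps of a pair cancel. So composition becomes symmetric difference.\<close>

lemma flip_comp:
  assumes "sparse J" "K \<subseteq> J" "L \<subseteq> J"
  shows "flip K \<circ> flip L = flip ((K - L) \<union> (L - K))"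
proof
  fix i
  have M: "(K - L) \<union> (L - K) \<subseteq> J" using assms by blast
  note at = flip_at[OF assms(1,2)] flip_at[OF assms(1,3)] flip_at[OF assms(1) M]
  note other = flip_other[OF assms(2)] flip_other[OF assms(3)] flip_other[OF M]
  consider "i \<in> J" | j where "j \<in> J" "i = Suc j" | "i \<notin> J" "i \<notin> Suc ` J" by blast
  then show "(flip K \<circ> flip L) i = flip ((K - L) \<union> (L - K)) i"
  proof cases
    case 1
    then show ?thesis by (simp add: at)
  next
    case 2
    then show ?thesis by (simp add: at)
  next
    case 3
    then show ?thesis by (simp add: other)
  qed
qed

lemma adj_transp_eq_flip: "adj_transp j = flip {j}"
  by (auto simp: fun_eq_iff flip_def adj_transp_def Transposition.transpose_def)

text \<open>Used to add one swap at a time: as \<open>flip K\<close> fixes \<open>j\<close> and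
  \<open>Suc j\<close>, the swaps already made affect neither the descent nor the edge direction at
  \<open>j\<close>.\<close>

lemma flip_insert:
  assumes "sparse (insert j K)" "j \<notin> K"
  shows "flip (insert j K) = flip K \<circ> adj_transp j"
    "flip K j = j" "flip K (Suc j) = Suc j"
proof -
  have "(K - {j}) \<union> ({j} - K) = insert j K"
    using assms(2) by blast
  then show "flip (insert j K) = flip K \<circ> adj_transp j"
    using flip_comp[OF assms(1), of K "{j}"] by (simp add: adj_transp_eq_flip subset_insertI)
  show "flip K j = j" "flip K (Suc j) = Suc j"
    using flip_at[OF assms(1), of K j] assms(2) by auto
qed

lemma adj_transp_comp [simp]: "adj_transp j \<circ> adj_transp j = id"
  by (simp add: adj_transp_def)

lemma flip_permutes:
  assumes "finite K" "sparse K" "K \<subseteq> {1..<n}"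
  shows "flip K permutes {1..n}"
  using assms
proof (induction K rule: finite_induct)
  case (insert j K)
  then have "flip K permutes {1..n}"
    by (meson insert_subset sparse_subset subset_insertI)
  moreover have "adj_transp j permutes {1..n}"
    using insert.prems by (intro adj_transp_permutes) auto
  ultimately show ?case
    unfolding flip_insert(1)[OF insert.prems(1) insert.hyps(2)] by (rule permutes_compose[rotated])
next
  case empty
  show ?case unfolding flip_empty by (rule permutes_id)
qed

lemma parabolic_sparse:
  assumes J: "sparse J" "J \<subseteq> {1..<n}"
  shows "parabolic n J = flip ` Pow J"
proof
  have "g \<in> flip ` Pow J" if "g \<in> generate (sym_group n) (adj_transp ` J)" for g
    using that
  proof (induction rule: generate.induct)
    case one
    show ?case
      unfolding sym_group_one using flip_empty by (metis Pow_bottom imageI)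
  next
    case (incl h)
    then show ?case by (auto simp: adj_transp_eq_flip)
  next
    case (inv h)
    then obtain j where j: "j \<in> J" "h = adj_transp j" by blast
    have "inv\<^bsub>sym_group n\<^esub> h = h"
      using J(2) j adj_transp_permutes[of j n]
      by (intro group.inv_equality[OF sym_group_is_group]) (auto simp: sym_group_mult sym_group_one sym_group_carrier)
    then show ?case using j by (auto simp: adj_transp_eq_flip)
  next
    case (eng h1 h2)
    then obtain K L where KL: "h1 = flip K" "h2 = flip L" "K \<subseteq> J" "L \<subseteq> J" by blast
    show ?case
      unfolding sym_group_mult KL(1,2) flip_comp[OF J(1) KL(3,4)] using KL(3,4) by blast
  qed
  then show "parabolic n J \<subseteq> flip ` Pow J"
    unfolding parabolic_def by blast
  have "flip K \<in> parabolic n J" if "K \<subseteq> J" "finite K" for K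
    using that(2,1)
  proof (induction K rule: finite_induct)
    case empty
    show ?case
      unfolding flip_empty parabolic_def using generate.one by (metis sym_group_one)
  next
    case (insert j K)
    have "sparse (insert j K)"
      using J(1) insert.prems by (rule sparse_subset)
    then have "flip (insert j K) = flip K \<otimes>\<^bsub>sym_group n\<^esub> adj_transp j"
      unfolding sym_group_mult by (rule flip_insert(1)) fact
    moreover have "flip K \<in> parabolic n J" "adj_transp j \<in> adj_transp ` J"
      using insert by auto
    ultimately show ?case
      unfolding parabolic_def by (simp only: generate.eng generate.incl)
  qed
  moreover have "finite J" using J(2) finite_subset by blast
  ultimately show "flip ` Pow J \<subseteq> parabolic n J"
    using finite_subset by blast
qed

definition weight :: "nat \<Rightarrow> (nat \<Rightarrow> nat) \<Rightarrow> nat" where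
  "weight n p = (\<Sum>i=1..n. i * p i)"

lemma weight_adj_transp_less:
  assumes "i \<in> {1..<n}" "p (Suc i) < p i"
  shows "weight n p < weight n (p \<circ> adj_transp i)"
proof -
  define R where "R = {1..n} - {i, Suc i}"
  have n: "{1..n} = insert i (insert (Suc i) R)" and R: "i \<notin> R" "Suc i \<notin> R" "finite R"
    using assms(1) by (auto simp: R_def)
  have "(\<Sum>k\<in>R. k * (p \<circ> adj_transp i) k) = (\<Sum>k\<in>R. k * p k)"
    by (rule sum.cong) (auto simp: R_def adj_transp_def)
  \<comment> \<open>The terms at \<open>i\<close> and \<open>Suc i\<close> change the sum by
    \<open>p i - p (Suc i)\<close>; the additive form avoids truncated subtraction.\<close>
  then have "weight n (p \<circ> adj_transp i) + p (Suc i) = weight n p + p i"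
    unfolding weight_def n using R by simp
  then show ?thesis using assms(2) by linarith
qed

lemma descents_empty_imp_id:
  assumes p: "p permutes {1..n}" and "descents n p = {}"
  shows "p = id"
proof (rule permutes_natset_ge[OF p])
  have less: "p i < p (Suc i)" if "i \<in> {1..<n}" for i
  proof -
    have "p i \<noteq> p (Suc i)"
      using permutes_inj[OF p] by (simp add: inj_eq)
    moreover have "\<not> p (Suc i) < p i"
      using assms(2) that unfolding descents_def by blast
    ultimately show ?thesis by linarith
  qed
  have "i \<le> n \<longrightarrow> i \<le> p i" if "1 \<le> i" for i
    using that
  proof (induction i rule: dec_induct)
    case base
    then show ?case using permutes_in_image[OF p, of 1] by auto
  next
    case (step i)
    then show ?case using less[of i] by auto
  qed
  then show "\<forall>i\<in>{1..n}. i \<le> p i" by simp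
qed

section \<open>The cube below a permutation\<close>

text \<open>In \<open>perm_vertex n p\<close> the coordinate indexed by \<open>p k\<close> is the
  position \<open>k\<close>, so swapping the positions \<open>j\<close> and \<open>Suc j\<close>
  raises the coordinate at \<open>p j\<close> by one and lowers that at \<open>p (Suc j)\<close> by
  one.\<close>

definition edge_dir :: "(nat \<Rightarrow> nat) \<Rightarrow> nat \<Rightarrow> nat \<Rightarrow>\<^sub>0 real" where
  "edge_dir p j = Poly_Mapping.single (p j) 1 - Poly_Mapping.single (p (Suc j)) 1"

lemma lookup_perm_vertex:
  assumes "p permutes {1..n}"
  shows "Poly_Mapping.lookup (perm_vertex n p) (p k) = (if k \<in> {1..n} then real k else 0)"
proof -
  have "Poly_Mapping.lookup (perm_vertex n p) (p k)
      = (\<Sum>i=1..n. if i = p k then real (inv' p i) else 0)"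
    unfolding perm_vertex_def lookup_sum by (rule sum.cong) (auto simp: lookup_single when_def)
  also have "\<dots> = (if p k \<in> {1..n} then real (inv' p (p k)) else 0)"
    by simp
  also have "\<dots> = (if k \<in> {1..n} then real k else 0)"
    unfolding permutes_in_image[OF assms] permutes_inverses(2)[OF assms] ..
  finally show ?thesis .
qed

lemma lookup_edge_dir:
  assumes "p permutes S"
  shows "Poly_Mapping.lookup (edge_dir p j) (p k) = of_bool (k = j) - of_bool (k = Suc j)"
  using inj_eq[OF permutes_inj[OF assms]]
  by (auto simp: edge_dir_def lookup_minus lookup_single when_def)

lemma perm_vertex_adj_transp:
  assumes p: "p permutes {1..n}" and j: "j \<in> {1..<n}"
  shows "perm_vertex n (p \<circ> adj_transp j) = perm_vertex n p + edge_dir p j"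
proof (rule poly_mapping_eqI)
  fix a
  obtain k where k: "a = p k"
    using permutes_surj[OF p] by (metis surjD)
  have q: "p \<circ> adj_transp j permutes {1..n}"
    by (rule permutes_compose[OF adj_transp_permutes[OF j] p])
  have "Poly_Mapping.lookup (perm_vertex n (p \<circ> adj_transp j)) a
      = (if adj_transp j k \<in> {1..n} then real (adj_transp j k) else 0)"
    using lookup_perm_vertex[OF q, of "adj_transp j k"] by (simp add: k)
  also have "\<dots> = (if k \<in> {1..n} then real k else 0) + (of_bool (k = j) - of_bool (k = Suc j))"
    using j by (auto simp: adj_transp_def Transposition.transpose_def)
  also have "\<dots> = Poly_Mapping.lookup (perm_vertex n p + edge_dir p j) a"
    by (simp add: k lookup_add lookup_perm_vertex[OF p] lookup_edge_dir[OF p])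
  finally show "Poly_Mapping.lookup (perm_vertex n (p \<circ> adj_transp j)) a
      = Poly_Mapping.lookup (perm_vertex n p + edge_dir p j) a" .
qed

lemma perm_vertex_flip:
  assumes p: "p permutes {1..n}" and "finite K" "sparse K" "K \<subseteq> {1..<n}"
  shows "perm_vertex n (p \<circ> flip K) = perm_vertex n p + (\<Sum>j\<in>K. edge_dir p j)"
  using assms(2-)
proof (induction K rule: finite_induct)
  case empty
  show ?case unfolding flip_empty comp_id by simp
next
  case (insert j K)
  note flip = flip_insert[OF insert.prems(1) insert.hyps(2)]
  have K: "sparse K" "K \<subseteq> {1..<n}"
    using insert.prems sparse_subset by blast+
  have "p \<circ> flip K permutes {1..n}"
    by (rule permutes_compose[OF flip_permutes[OF insert.hyps(1) K] p])
  moreover have "j \<in> {1..<n}" using insert.prems by blast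
  ultimately have "perm_vertex n (p \<circ> flip K \<circ> adj_transp j)
      = perm_vertex n (p \<circ> flip K) + edge_dir (p \<circ> flip K) j"
    by (rule perm_vertex_adj_transp)
  also have "edge_dir (p \<circ> flip K) j = edge_dir p j"
    using flip(2,3) by (simp add: edge_dir_def)
  finally show ?case
    unfolding flip(1) comp_assoc insert.IH[OF K] using insert.hyps by simp
qed

text \<open>Parameter \<open>0\<close> keeps the descent \<open>j\<close>, parameter
  \<open>1\<close> removes it; all parameters \<open>0\<close> give the vertex of
  \<open>w\<close>.\<close>

definition cube_point :: "nat \<Rightarrow> (nat \<Rightarrow> nat) \<Rightarrow> (nat \<Rightarrow> real) \<Rightarrow> nat \<Rightarrow>\<^sub>0 real" where
  "cube_point n w t = perm_vertex n w + (\<Sum>j\<in>descents n w. t j *\<^sub>R edge_dir w j)"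

definition cube :: "nat \<Rightarrow> (nat \<Rightarrow> nat) \<Rightarrow> (nat \<Rightarrow>\<^sub>0 real) set" where
  "cube n w = {cube_point n w t | t. \<forall>j\<in>descents n w. 0 \<le> t j \<and> t j \<le> 1}"

text \<open>Half-open: the facets through the vertex of \<open>w\<close> are kept and the opposite
  ones omitted, so that these sets can partition the union of the cubes.\<close>

definition open_cube :: "nat \<Rightarrow> (nat \<Rightarrow> nat) \<Rightarrow> (nat \<Rightarrow>\<^sub>0 real) set" where
  "open_cube n w = {cube_point n w t | t. \<forall>j\<in>descents n w. 0 \<le> t j \<and> t j < 1}"

lemma descents_subset: "descents n p \<subseteq> {1..<n}"
  by (auto simp: descents_def)

lemma cube_eq_hull:
  assumes "w permutes {1..n}" "sparse (descents n w)"
  shows "cube n w = convex hull (perm_vertex n ` (\<lambda>K. w \<circ> flip K) ` Pow (descents n w))"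
proof -
  have "perm_vertex n (w \<circ> flip K) = perm_vertex n w + sum (edge_dir w) K"
    if "K \<subseteq> descents n w" for K
    using that descents_subset[of n w] assms
    by (intro perm_vertex_flip) (auto intro: finite_subset sparse_subset)
  then have "perm_vertex n ` (\<lambda>K. w \<circ> flip K) ` Pow (descents n w)
      = {perm_vertex n w + sum (edge_dir w) K | K. K \<subseteq> descents n w}"
    by (auto simp: image_image)
  then show ?thesis
    by (simp add: convex_hull_subset_sums cube_def cube_point_def)
qed

lemma closed_cube:
  assumes "w permutes {1..n}" "sparse (descents n w)"
  shows "closed (cube n w)"
  unfolding cube_eq_hull[OF assms]
  by (intro compact_imp_closed finite_imp_compact_convex_hull) simp

text \<open>Position \<open>k\<close> may be first in the pair at \<open>k\<close> and second in the
  pair at \<open>k - 1\<close>. For \<open>k = 1\<close> the last term vanishes, since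
  \<open>0\<close> is no descent.\<close>

lemma lookup_cube_point:
  assumes w: "w permutes {1..n}" and "k \<in> {1..n}"
  shows "Poly_Mapping.lookup (cube_point n w t) (w k) = real k
       + (if k \<in> descents n w then t k else 0) - (if k - 1 \<in> descents n w then t (k - 1) else 0)"
proof -
  have "(\<Sum>j\<in>descents n w. t j * of_bool (k = Suc j))
      = (\<Sum>j\<in>descents n w. if j = k - 1 then t j else 0)"
    using assms(2) by (intro sum.cong) auto
  moreover have "(\<Sum>j\<in>descents n w. t j * of_bool (k = j))
      = (\<Sum>j\<in>descents n w. if j = k then t j else 0)"
    by (intro sum.cong) auto
  ultimately show ?thesis
    using assms(2)
    by (simp add: cube_point_def lookup_add lookup_sum lookup_scaleR lookup_perm_vertex[OF w]
        lookup_edge_dir[OF w] right_diff_distrib sum_subtractf)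
qed

text \<open>Sparsity removes the contribution of \<open>j - 1\<close>, so the parameter
  \<open>t j\<close> can be read off from the point.\<close>

lemma lookup_cube_point_descent:
  assumes "w permutes {1..n}" "sparse (descents n w)" "j \<in> descents n w"
  shows "Poly_Mapping.lookup (cube_point n w t) (w j) = real j + t j"
proof -
  have "j \<in> {1..n}" "j - 1 \<notin> descents n w"
    using assms(2,3) by (auto simp: descents_def sparse_def)
  then show ?thesis
    using assms(3) by (simp add: lookup_cube_point[OF assms(1)])
qed

text \<open>Sorting the values \<open>a\<close> by the integral part of their coordinate \<open>x\<^sub>a\<close>, and by decreasing \<open>a\<close> in
  case of a tie, recovers \<open>w\<close> from a point of its half-open cube: the coordinates of a descent pair
  are \<open>j + t\<close> and \<open>j + 1 - t\<close>, which have the same integral part unless \<open>t = 0\<close>.\<close>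

definition sorts_before :: "(nat \<Rightarrow>\<^sub>0 real) \<Rightarrow> nat \<Rightarrow> nat \<Rightarrow> bool" where
  "sorts_before x a b \<longleftrightarrow> \<lfloor>Poly_Mapping.lookup x a\<rfloor> < \<lfloor>Poly_Mapping.lookup x b\<rfloor>
     \<or> \<lfloor>Poly_Mapping.lookup x a\<rfloor> = \<lfloor>Poly_Mapping.lookup x b\<rfloor> \<and> b < a"

lemma sorts_before_asym: "sorts_before x a b \<Longrightarrow> \<not> sorts_before x b a"
  by (auto simp: sorts_before_def)

lemma open_cube_sorted:
  assumes w: "w permutes {1..n}" "sparse (descents n w)" and x: "x \<in> open_cube n w"
    and ik: "1 \<le> i" "i < k" "k \<le> n"
  shows "sorts_before x (w i) (w k)"
proof -
  obtain t where x_eq: "x = cube_point n w t"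
    and t: "\<And>j. j \<in> descents n w \<Longrightarrow> 0 \<le> t j \<and> t j < 1"
    using x unfolding open_cube_def by blast
  note look = lookup_cube_point[OF w(1), of _ t, folded x_eq]
  have desc: "\<lfloor>Poly_Mapping.lookup x (w j)\<rfloor> = int j" if "j \<in> descents n w" for j
    using lookup_cube_point_descent[OF w that, of t, folded x_eq] t[OF that] by linarith
  \<comment> \<open>The integral part falls short of the position only at the second place of a
    descent pair with positive parameter.\<close>
  have fl: "\<lfloor>Poly_Mapping.lookup x (w j)\<rfloor> = int j
      \<or> j - 1 \<in> descents n w \<and> \<lfloor>Poly_Mapping.lookup x (w j)\<rfloor> = int j - 1"
    if "j \<in> {1..n}" for j
  proof -
    consider "j \<in> descents n w" | "j \<notin> descents n w" "j - 1 \<in> descents n w"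
      | "j \<notin> descents n w" "j - 1 \<notin> descents n w" by blast
    then show ?thesis
    proof cases
      case 1
      then show ?thesis by (simp add: desc)
    next
      case 2
      then have "Poly_Mapping.lookup x (w j) = real j - t (j - 1)"
        using look[OF that] by simp
      then show ?thesis using t[OF 2(2)] 2(2) by linarith
    next
      case 3
      then show ?thesis using look[OF that] by simp
    qed
  qed
  have "i \<in> {1..n}" "k \<in> {1..n}" using ik by auto
  from this[THEN fl] show ?thesis
  proof (elim disjE conjE)
    \<comment> \<open>The only case with a possible tie: if \<open>i = k - 1\<close>, the two
      entries form a descent pair, and \<open>w k < w i\<close> decides.\<close>
    assume *: "k - 1 \<in> descents n w"
      and k: "\<lfloor>Poly_Mapping.lookup x (w k)\<rfloor> = int k - 1"
      and i: "\<lfloor>Poly_Mapping.lookup x (w i)\<rfloor> = int i"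
    show ?thesis
    proof (cases "i = k - 1")
      case True
      then have "w k < w i" using * ik by (auto simp: descents_def)
      moreover have "int i = int k - 1" using True ik by simp
      ultimately show ?thesis using i k by (simp add: sorts_before_def)
    next
      case False
      then have "int i < int k - 1" using ik by linarith
      then show ?thesis using i k by (simp add: sorts_before_def)
    qed
  qed (use ik in \<open>auto simp: sorts_before_def\<close>)
qed

text \<open>Both \<open>w\<close> and \<open>w'\<close> list \<open>{1..n}\<close> in the order
  \<open>sorts_before x\<close>, so the permutation \<open>p\<close> relating them has no
  descent.\<close>

lemma open_cube_disjoint:
  assumes w: "w permutes {1..n}" "sparse (descents n w)" "x \<in> open_cube n w"
    and w': "w' permutes {1..n}" "sparse (descents n w')" "x \<in> open_cube n w'"
  shows "w = w'"
proof -
  define p where "p = inv' w' \<circ> w"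
  have p: "p permutes {1..n}"
    unfolding p_def by (rule permutes_compose[OF w(1) permutes_inv[OF w'(1)]])
  have w_eq: "w k = w' (p k)" for k
    using permutes_inverses(1)[OF w'(1)] by (simp add: p_def)
  have "\<not> p (Suc i) < p i" if i: "i \<in> {1..<n}" for i
  proof
    assume less: "p (Suc i) < p i"
    have "p i \<in> {1..n}" "p (Suc i) \<in> {1..n}"
      using i by (simp_all only: permutes_in_image[OF p]) auto
    then have "sorts_before x (w' (p (Suc i))) (w' (p i))"
      using less by (intro open_cube_sorted[OF w']) auto
    moreover have "sorts_before x (w i) (w (Suc i))"
      using i by (intro open_cube_sorted[OF w]) auto
    ultimately show False
      using sorts_before_asym by (simp add: w_eq)
  qed
  then have "descents n p = {}" by (auto simp: descents_def)
  then have "p = id" by (rule descents_empty_imp_id[OF p])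
  then show ?thesis using w_eq by (simp add: fun_eq_iff)
qed

text \<open>At \<open>t j = 1\<close> the pair at \<open>j\<close> has been swapped; by sparsity the
  other descents of \<open>w\<close> survive with the same edge directions.\<close>

lemma cube_point_in_smaller_cube:
  assumes w: "w permutes {1..n}" "sparse (descents n w)"
    and j: "j \<in> descents n w" "t j = 1"
    and t: "\<forall>i\<in>descents n w. 0 \<le> t i \<and> t i \<le> 1"
  shows "cube_point n w t \<in> cube n (w \<circ> adj_transp j)"
proof -
  define w' where "w' = w \<circ> adj_transp j"
  define E where "E = descents n w - {j}"
  \<comment> \<open>Removing \<open>j\<close> may create new descents, which get parameter
    \<open>0\<close>.\<close>
  define t' where "t' = (\<lambda>i. if i \<in> E then t i else 0)"
  have jn: "j \<in> {1..<n}" using j by (auto simp: descents_def)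
  have same: "w' i = w i" "w' (Suc i) = w (Suc i)" if "i \<in> E" for i
    using that w(2) j(1) by (auto simp: w'_def E_def sparse_def intro!: arg_cong[of _ _ w] adj_transp_other)
  have sub: "E \<subseteq> descents n w'"
    using same by (auto simp: descents_def E_def)
  have "(\<Sum>i\<in>descents n w. t i *\<^sub>R edge_dir w i) = edge_dir w j + (\<Sum>i\<in>E. t i *\<^sub>R edge_dir w i)"
    unfolding E_def by (subst sum.remove[OF _ j(1)]) (simp_all add: j(2))
  also have "(\<Sum>i\<in>E. t i *\<^sub>R edge_dir w i) = (\<Sum>i\<in>descents n w'. t' i *\<^sub>R edge_dir w' i)"
    using sub same by (intro sum.mono_neutral_cong_left) (auto simp: t'_def edge_dir_def)
  finally have "cube_point n w t = cube_point n w' t'"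
    using perm_vertex_adj_transp[OF w(1) jn] by (simp add: cube_point_def w'_def)
  moreover have "\<forall>i\<in>descents n w'. 0 \<le> t' i \<and> t' i \<le> 1"
    using t by (auto simp: t'_def E_def)
  ultimately show ?thesis
    unfolding cube_def w'_def by blast
qed

text \<open>The cube is pushed along its diagonal until some parameter reaches \<open>1\<close>.\<close>

lemma cube_retracts_to_upper_faces:
  assumes w: "w permutes {1..n}" "sparse (descents n w)" and ne: "descents n w \<noteq> {}"
  obtains h where "continuous_on ({0..1::real} \<times> cube n w) h"
    "\<And>s x. s \<in> {0..1} \<Longrightarrow> x \<in> cube n w \<Longrightarrow> h (s, x) \<in> cube n w"
    "\<And>x. x \<in> cube n w \<Longrightarrow> h (0, x) = x"
    "\<And>x. x \<in> cube n w \<Longrightarrow> \<exists>j\<in>descents n w. h (1, x) \<in> cube n (w \<circ> adj_transp j)"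
    "\<And>s x. x \<in> cube n w \<Longrightarrow> x \<notin> open_cube n w \<Longrightarrow> h (s, x) = x"
proof -
  define D where "D = descents n w"
  have D: "finite D" "D \<noteq> {}" using ne by (auto simp: D_def)
  \<comment> \<open>On a cube point the terms are \<open>1 - t j\<close>, so \<open>m\<close> says
    how far all parameters can grow together. Written in coordinates, it is continuous and needs no
    choice of \<open>t\<close>.\<close>
  define m where "m = (\<lambda>x. Min ((\<lambda>j. real j + 1 - Poly_Mapping.lookup x (w j)) ` D))"
  define h where "h = (\<lambda>(s, x). x + (s * m x) *\<^sub>R (\<Sum>j\<in>D. edge_dir w j))"
  have m: "m (cube_point n w t) = Min ((\<lambda>j. 1 - t j) ` D)" for t
    unfolding m_def
    by (intro arg_cong[of _ _ Min] image_cong) (auto simp: D_def lookup_cube_point_descent[OF w])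
  have h_point: "h (s, cube_point n w t)
      = cube_point n w (\<lambda>j. t j + s * Min ((\<lambda>j. 1 - t j) ` D))" for s t
    by (simp add: h_def m, simp add: cube_point_def D_def scaleR_left_distrib sum.distrib scaleR_sum_right)
  have bounds: "0 \<le> Min ((\<lambda>j. 1 - t j) ` D)"
    "\<And>j. j \<in> D \<Longrightarrow> Min ((\<lambda>j. 1 - t j) ` D) \<le> 1 - t j"
    if "\<forall>j\<in>D. 0 \<le> t j \<and> t j \<le> 1" for t :: "nat \<Rightarrow> real"
    using that D by auto
  show thesis
  proof (rule that)
    have "continuous_on ({0..1} \<times> cube n w) (\<lambda>z. m (snd z))"
      unfolding m_def by (intro continuous_on_Min_image D continuous_intros)
    then show "continuous_on ({0..1} \<times> cube n w) h"
      unfolding h_def case_prod_unfold by (intro continuous_intros)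
  next
    fix s :: real and x assume s: "s \<in> {0..1}" and "x \<in> cube n w"
    then obtain t where t: "x = cube_point n w t" "\<forall>j\<in>D. 0 \<le> t j \<and> t j \<le> 1"
      unfolding cube_def D_def by blast
    define M where "M = Min ((\<lambda>j. 1 - t j) ` D)"
    have "0 \<le> t j + s * M \<and> t j + s * M \<le> 1" if "j \<in> D" for j
    proof -
      have "0 \<le> M" "M \<le> 1 - t j"
        using bounds[OF t(2)] that by (auto simp: M_def)
      moreover have "s * M \<le> M"
        using s \<open>0 \<le> M\<close> by (simp add: mult_left_le_one_le)
      ultimately show ?thesis using s t(2) that by fastforce
    qed
    then show "h (s, x) \<in> cube n w"
      unfolding t(1) h_point cube_def M_def D_def by blast
  next
    fix x
    show "h (0, x) = x" by (simp add: h_def)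
  next
    fix x assume "x \<in> cube n w"
    then obtain t where t: "x = cube_point n w t" "\<forall>j\<in>D. 0 \<le> t j \<and> t j \<le> 1"
      unfolding cube_def D_def by blast
    define M where "M = Min ((\<lambda>j. 1 - t j) ` D)"
    have "M \<in> (\<lambda>j. 1 - t j) ` D"
      unfolding M_def using D by (intro Min_in) auto
    then obtain j where j: "j \<in> D" "M = 1 - t j" by blast
    have "h (1, x) = cube_point n w (\<lambda>i. t i + M)"
      by (simp add: t(1) h_point M_def)
    moreover have "0 \<le> t i + M \<and> t i + M \<le> 1" if "i \<in> D" for i
      using bounds[OF t(2)] t(2) that unfolding M_def by fastforce
    ultimately show "\<exists>j\<in>descents n w. h (1, x) \<in> cube n (w \<circ> adj_transp j)"
      using j cube_point_in_smaller_cube[OF w, of j "\<lambda>i. t i + M"] by (auto simp: D_def)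
  next
    fix s x assume "x \<in> cube n w" and x: "x \<notin> open_cube n w"
    then obtain t where t: "x = cube_point n w t" "\<forall>j\<in>D. 0 \<le> t j \<and> t j \<le> 1"
      unfolding cube_def D_def by blast
    \<comment> \<open>Off the half-open cube some parameter is already \<open>1\<close>, so the
      point does not move.\<close>
    obtain j where j: "j \<in> D" "\<not> t j < 1"
      using x t unfolding open_cube_def D_def by blast
    then have "Min ((\<lambda>j. 1 - t j) ` D) = 0"
      using bounds[OF t(2)] by fastforce
    then show "h (s, x) = x" by (simp add: t(1) h_point)
  qed
qed

section \<open>Sets of permutations closed under removing descents\<close>

text \<open>The properties of \<open>bS n\<close> behind the collapses, in a form that survives
  removing a non-identity element of least weight, as the induction requires.\<close>

definition descent_closed :: "nat \<Rightarrow> (nat \<Rightarrow> nat) set \<Rightarrow> bool" where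
  "descent_closed n A \<longleftrightarrow> (\<forall>w\<in>A. w permutes {1..n} \<and> sparse (descents n w)
     \<and> (\<forall>j\<in>descents n w. w \<circ> adj_transp j \<in> A))"

lemma descent_closedD:
  assumes "descent_closed n A" "w \<in> A"
  shows "w permutes {1..n}" "sparse (descents n w)"
    "\<And>j. j \<in> descents n w \<Longrightarrow> w \<circ> adj_transp j \<in> A"
  using assms by (auto simp only: descent_closed_def)

lemma finite_descent_closed:
  assumes "descent_closed n A"
  shows "finite A"
proof (rule finite_subset)
  show "A \<subseteq> {p. p permutes {1..n}}" using descent_closedD(1)[OF assms] by blast
qed (simp add: finite_permutations)

lemma remove_descents:
  assumes A: "descent_closed n A" and "w \<in> A" "K \<subseteq> descents n w"
  shows "w \<circ> flip K \<in> A"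
proof -
  have "finite K" using assms(3) finite_subset finite_descents by blast
  then show ?thesis using assms(3)
  proof (induction K rule: finite_induct)
    case empty
    then show ?case using assms(2) unfolding flip_empty comp_id by simp
  next
    case (insert j K)
    have "sparse (insert j K)"
      using sparse_subset descent_closedD(2)[OF A assms(2)] insert.prems by blast
    note flip = flip_insert[OF this insert.hyps(2)]
    have "j \<in> descents n (w \<circ> flip K)"
      using insert.prems flip(2,3) by (simp add: descents_def)
    moreover have "w \<circ> flip K \<in> A"
      by (rule insert.IH) (use insert.prems in blast)
    ultimately show ?case
      unfolding flip(1) comp_assoc[symmetric] by (intro descent_closedD(3)[OF A])
  qed
qed

text \<open>Among the cubes through \<open>x\<close>, that of an element of greatest weight serves:
  a parameter \<open>1\<close> would put \<open>x\<close> into the cube of a heavier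
  element.\<close>

lemma cubes_eq_open_cubes:
  assumes A: "descent_closed n A"
  shows "(\<Union>w\<in>A. cube n w) = (\<Union>w\<in>A. open_cube n w)"
proof
  show "(\<Union>w\<in>A. open_cube n w) \<subseteq> (\<Union>w\<in>A. cube n w)"
    unfolding cube_def open_cube_def by (fastforce intro: less_imp_le)
  show "(\<Union>w\<in>A. cube n w) \<subseteq> (\<Union>w\<in>A. open_cube n w)"
  proof
    fix x assume "x \<in> (\<Union>w\<in>A. cube n w)"
    define S where "S = {w \<in> A. x \<in> cube n w}"
    have S: "finite S" "S \<noteq> {}"
      using finite_descent_closed[OF A] \<open>x \<in> _\<close> by (auto simp: S_def)
    then have "Max (weight n ` S) \<in> weight n ` S"
      by (intro Max_in) auto
    then obtain w where w: "w \<in> A" "x \<in> cube n w" and "weight n w = Max (weight n ` S)"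
      by (auto simp: S_def)
    then have max: "weight n v \<le> weight n w" if "v \<in> A" "x \<in> cube n v" for v
      using S(1) that by (auto simp: S_def)
    obtain t where t: "x = cube_point n w t" "\<forall>j\<in>descents n w. 0 \<le> t j \<and> t j \<le> 1"
      using w(2) unfolding cube_def by blast
    have "t j < 1" if j: "j \<in> descents n w" for j
    proof (rule ccontr)
      assume "\<not> t j < 1"
      then have "t j = 1" using t(2) j by force
      then have "x \<in> cube n (w \<circ> adj_transp j)"
        using t(2) unfolding t(1)
        by (intro cube_point_in_smaller_cube descent_closedD[OF A] w j)
      then have "weight n (w \<circ> adj_transp j) \<le> weight n w"
        by (intro max descent_closedD(3)[OF A] w j)
      moreover have "weight n w < weight n (w \<circ> adj_transp j)"
        using j by (intro weight_adj_transp_less) (auto simp: descents_def)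
      ultimately show False by simp
    qed
    then have "x \<in> open_cube n w"
      using t unfolding open_cube_def by blast
    then show "x \<in> (\<Union>w\<in>A. open_cube n w)" using w(1) by blast
  qed
qed

lemma coset_descents:
  assumes A: "descent_closed n A" and "w \<in> A" "J \<subseteq> descents n w"
  shows "w <#\<^bsub>sym_group n\<^esub> parabolic n J = (\<lambda>K. w \<circ> flip K) ` Pow J"
proof -
  have "sparse J" "J \<subseteq> {1..<n}"
    using sparse_subset[OF descent_closedD(2)[OF A]] assms(2,3) descents_subset by blast+
  then show ?thesis
    by (auto simp: parabolic_sparse l_coset_def sym_group_mult)
qed

text \<open>Each cube is the face of the coset of \<open>w\<close> by its descents. Conversely, an
  element of least weight in a coset has all of \<open>J\<close> among its descents, so its cube
  contains the face.\<close>

lemma faces_eq_cubes: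
  assumes A: "descent_closed n A"
  shows "(\<Union>C \<in> {C \<in> parabolic_cosets n. C \<subseteq> A}. perm_face n C) = (\<Union>w\<in>A. cube n w)"
proof (intro equalityI UN_least)
  fix w assume w: "w \<in> A"
  let ?C = "w <#\<^bsub>sym_group n\<^esub> parabolic n (descents n w)"
  note C = coset_descents[OF A w order_refl]
  have "cube n w = perm_face n ?C"
    unfolding C perm_face_def by (rule cube_eq_hull[OF descent_closedD(1)[OF A w] descent_closedD(2)[OF A w]])
  moreover have "?C \<in> parabolic_cosets n"
    using descent_closedD(1)[OF A w] descents_subset unfolding parabolic_cosets_def sym_group_carrier by blast
  moreover have "?C \<subseteq> A"
    unfolding C using remove_descents[OF A w] by blast
  ultimately show "cube n w \<subseteq> (\<Union>C \<in> {C \<in> parabolic_cosets n. C \<subseteq> A}. perm_face n C)"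
    by blast
next
  fix C assume "C \<in> {C \<in> parabolic_cosets n. C \<subseteq> A}"
  then obtain p J where C: "C = p <#\<^bsub>sym_group n\<^esub> parabolic n J" "C \<subseteq> A"
    and p: "p \<in> carrier (sym_group n)" and J: "J \<subseteq> {1..<n}"
    unfolding parabolic_cosets_def by blast
  have "adj_transp ` J \<subseteq> carrier (sym_group n)"
    using J adj_transp_permutes by (auto simp: sym_group_carrier)
  then have sub: "subgroup (parabolic n J) (sym_group n)"
    unfolding parabolic_def by (rule group.generate_is_subgroup[OF sym_group_is_group])
  have "p \<otimes>\<^bsub>sym_group n\<^esub> \<one>\<^bsub>sym_group n\<^esub> \<in> C"
    unfolding C(1) l_coset_def using subgroup.one_closed[OF sub] by blast
  then have "weight n ` C \<noteq> {}" by blast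
  moreover have "finite (weight n ` C)"
    using finite_subset[OF C(2) finite_descent_closed[OF A]] by blast
  ultimately have "Min (weight n ` C) \<in> weight n ` C" "\<And>v. v \<in> C \<Longrightarrow> Min (weight n ` C) \<le> weight n v"
    by simp_all
  then obtain w where w: "w \<in> C" and min: "\<And>v. v \<in> C \<Longrightarrow> weight n w \<le> weight n v"
    by auto
  have C_eq: "C = w <#\<^bsub>sym_group n\<^esub> parabolic n J"
    using group.l_repr_independence[OF sym_group_is_group _ p sub] w unfolding C(1) by blast
  have "w \<in> A" using w C(2) by blast
  have desc: "J \<subseteq> descents n w"
  proof
    fix j assume j: "j \<in> J"
    then have jn: "j \<in> {1..<n}" using J by blast
    have "adj_transp j \<in> parabolic n J"
      unfolding parabolic_def using j by (intro generate.incl) blast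
    then have "w \<circ> adj_transp j \<in> C"
      unfolding C_eq l_coset_def sym_group_mult by blast
    then have "weight n w \<le> weight n (w \<circ> adj_transp j)" by (rule min)
    \<comment> \<open>An ascent of \<open>w\<close> at \<open>j\<close> is a descent of
      \<open>w \<circ> adj_transp j\<close>, whose removal gives back \<open>w\<close>; then
      \<open>w\<close> would be the heavier one.\<close>
    moreover have "weight n (w \<circ> adj_transp j) < weight n (w \<circ> adj_transp j \<circ> adj_transp j)"
      if "w j < w (Suc j)"
      using that by (intro weight_adj_transp_less[OF jn]) simp
    moreover have "w \<circ> adj_transp j \<circ> adj_transp j = w"
      unfolding comp_assoc adj_transp_comp comp_id ..
    moreover have "w j \<noteq> w (Suc j)"
      using permutes_inj[OF descent_closedD(1)[OF A \<open>w \<in> A\<close>]] by (simp add: inj_eq)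
    ultimately have "w (Suc j) < w j"
      by (metis leD linorder_neqE_nat)
    then show "j \<in> descents n w" using jn by (simp add: descents_def)
  qed
  have "C \<subseteq> (\<lambda>K. w \<circ> flip K) ` Pow (descents n w)"
    unfolding C_eq coset_descents[OF A \<open>w \<in> A\<close> desc] using desc by blast
  then have "perm_face n C \<subseteq> cube n w"
    unfolding cube_eq_hull[OF descent_closedD(1)[OF A \<open>w \<in> A\<close>] descent_closedD(2)[OF A \<open>w \<in> A\<close>]] perm_face_def
    by (intro hull_mono image_mono)
  then show "perm_face n C \<subseteq> (\<Union>w\<in>A. cube n w)" using \<open>w \<in> A\<close> by blast
qed

section \<open>Collapsing the cubes one by one\<close>

lemma cube_id: "cube n id = {perm_vertex n id}"
  by (auto simp: cube_def cube_point_def descents_def)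

lemma contractible_cubes:
  assumes "descent_closed n A" "id \<in> A"
  shows "contractible (\<Union>w\<in>A. cube n w)"
  using assms
proof (induction "card A" arbitrary: A rule: less_induct)
  case less
  note A = less.prems(1)
  note finite = finite_descent_closed[OF A]
  show ?case
  proof (cases "A = {id}")
    case True
    show ?thesis unfolding True by (simp add: cube_id)
  next
    case False
    then have "weight n ` (A - {id}) \<noteq> {}" using less.prems(2) by blast
    then have "Min (weight n ` (A - {id})) \<in> weight n ` (A - {id})"
      and min_le: "\<And>v. v \<in> A - {id} \<Longrightarrow> Min (weight n ` (A - {id})) \<le> weight n v"
      using finite by simp_all
    then obtain w where Min_eq: "Min (weight n ` (A - {id})) = weight n w" and "w \<in> A - {id}"
      by (elim imageE)
    then have w: "w \<in> A" "w \<noteq> id" by blast+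
    have min: "weight n w \<le> weight n v" if "v \<in> A" "v \<noteq> id" for v
      using min_le[of v] that unfolding Min_eq by blast
    \<comment> \<open>Removing a descent raises the weight, so it never leads to \<open>w\<close>,
      and \<open>A - {w}\<close> stays descent closed.\<close>
    have removed: "v \<circ> adj_transp j \<in> A - {w}" if v: "v \<in> A" and j: "j \<in> descents n v" for v j
    proof -
      have "v \<noteq> id" using j by (auto simp: descents_def)
      then have "weight n w \<le> weight n v" using min v by blast
      also have "\<dots> < weight n (v \<circ> adj_transp j)"
        using j by (intro weight_adj_transp_less) (auto simp: descents_def)
      finally show ?thesis using descent_closedD(3)[OF A v j] by blast
    qed
    have rest: "descent_closed n (A - {w})"
      using descent_closedD(1,2)[OF A] removed unfolding descent_closed_def by blast
    let ?R = "\<Union>v\<in>A - {w}. cube n v"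
    note w_cube = descent_closedD(1,2)[OF A w(1)]
    have "descents n w \<noteq> {}"
      using descents_empty_imp_id[OF w_cube(1)] w(2) by blast
    from cube_retracts_to_upper_faces[OF w_cube this] obtain h where
      h: "continuous_on ({0..1::real} \<times> cube n w) h"
        "\<And>s x. s \<in> {0..1} \<Longrightarrow> x \<in> cube n w \<Longrightarrow> h (s, x) \<in> cube n w"
        "\<And>x. x \<in> cube n w \<Longrightarrow> h (0, x) = x"
      and h1: "\<And>x. x \<in> cube n w \<Longrightarrow> \<exists>j\<in>descents n w. h (1, x) \<in> cube n (w \<circ> adj_transp j)"
      and h_fix: "\<And>s x. x \<in> cube n w \<Longrightarrow> x \<notin> open_cube n w \<Longrightarrow> h (s, x) = x"
      by blast
    have "contractible (?R \<union> cube n w)"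
    proof (rule contractible_Un_deformation_retract[OF _ _ _ h])
      show "closed ?R"
        using finite by (intro closed_UN ballI closed_cube descent_closedD(1,2)[OF rest]) auto
      show "closed (cube n w)" by (rule closed_cube[OF w_cube])
      have "card (A - {w}) < card A"
        using finite w(1) by (rule card_Diff1_less)
      then show "contractible ?R"
        using less.prems(2) w(2) by (intro less.hyps rest) auto
      show "h (1, x) \<in> ?R" if "x \<in> cube n w" for x
        using h1[OF that] removed[OF w(1)] by blast
      show "h (s, x) = x" if x: "x \<in> ?R" "x \<in> cube n w" for s x
      \<comment> \<open>A point of the other cubes lies in the half-open cube of another element,
        hence not in that of \<open>w\<close>, and only there does \<open>h\<close> move
        points.\<close>
      proof (rule h_fix[OF x(2)])
        obtain v where v: "v \<in> A - {w}" "x \<in> open_cube n v"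
          using x(1) unfolding cubes_eq_open_cubes[OF rest] by blast
        show "x \<notin> open_cube n w"
          using open_cube_disjoint[OF w_cube _ descent_closedD(1,2)[OF rest v(1)] v(2)]
            v(1) by blast
      qed
    qed
    also have "?R \<union> cube n w = (\<Union>v\<in>A. cube n v)" using w(1) by blast
    finally show ?thesis .
  qed
qed

lemma descent_closed_bS: "descent_closed n (bS n)"
  unfolding descent_closed_def
proof (intro ballI conjI)
  fix w assume "w \<in> bS n"
  then obtain ws where ws: "distinct ws" "set ws \<subseteq> {1..<n}" "w = word_perm ws"
    unfolding bS_eq by blast
  show "w permutes {1..n}" unfolding ws(3) by (rule word_perm_permutes[OF ws(2)])
  show "sparse (descents n w)"
    unfolding sparse_def using no_double_descent[OF ws(1)] by (auto simp: descents_def ws(3))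
  fix j assume "j \<in> descents n w"
  then have "word_perm ws (Suc j) < word_perm ws j" by (simp add: descents_def ws(3))
  then obtain ws' where ws': "distinct ws'" "set ws' = set ws - {j}"
    "word_perm ws \<circ> adj_transp j = word_perm ws'"
    by (rule descent_delete[OF ws(1)])
  have "set ws' \<subseteq> {1..<n}" using ws'(2) ws(2) by blast
  then show "w \<circ> adj_transp j \<in> bS n"
    unfolding bS_eq ws(3) ws'(3) using ws'(1) by blast
qed

section \<open>The three spaces\<close>

text \<open>Words are considered up to the Coxeter relations. The braid relation needs a repeated letter, so the
  words with distinct letters for an element of \<open>bS n\<close> differ by commutations only, and membership in
  \<open>bS n\<close> does not depend on the choice of the canonical word.\<close>

lemma adj_transp_commute_braid:
  "Suc i < j \<or> Suc j < i \<Longrightarrow> adj_transp i \<circ> adj_transp j = adj_transp j \<circ> adj_transp i"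
  "adj_transp i \<circ> adj_transp (Suc i) \<circ> adj_transp i
    = adj_transp (Suc i) \<circ> adj_transp i \<circ> adj_transp (Suc i)"
  by (auto simp: fun_eq_iff adj_transp_def Transposition.transpose_def)

lemma contractible_P_bS: "P_bS n \<noteq> {} \<and> contractible (P_bS n)"
proof
  have P: "P_bS n = (\<Union>w\<in>bS n. cube n w)"
    unfolding P_bS_def by (rule faces_eq_cubes[OF descent_closed_bS])
  show "P_bS n \<noteq> {}"
    unfolding P using id_in_bS cube_id by blast
  show "contractible (P_bS n)"
    unfolding P by (rule contractible_cubes[OF descent_closed_bS id_in_bS])
qed

theorem theorem1p11:
  fixes n :: nat
  assumes "n \<ge> 1"
  shows "(P_bS n \<noteq> {} \<and> contractible (P_bS n)) \<and>
         (B_bS n \<noteq> {} \<and> contractible (B_bS n)) \<and>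
         (W_bS n \<noteq> {} \<and> contractible (W_bS n))"
  by (intro conjI[OF contractible_P_bS conjI[OF contractible_B_bS contractible_W_bS]])

end
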